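(* Let $k$ be a field of characteristic zero, let $B$ be a $k$-domain and let $S=\{D_1,\dots,D_n\}$ be a set of locally nilpotent derivations of $B$. Then the $D_i$ are pairwise commuting and linearly independent over $B$ if and only if $S$ is a set of irredundant pairwise commuting locally nilpotent derivations of $B$.
   Context: A $k$-domain is an integral domain containing $k$. A derivation $D$ of $B$ is locally nilpotent if for every $b\in B$ there is a positive integer $m$ with $D^m(b)=0$. A set $\{D_1,\dots,D_m\}$ of locally nilpotent derivations of $B$ is irredundant pairwise commuting if the $D_i$ pairwise commute and $\bigcap_{j\neq i}\ker D_j\nsubseteq\ker D_i$ for all $1\le i\le m$ (an empty intersection is $B$). *)

theory Defs
  imports Complex_Main
begin

text \<open>
  A \<open>k\<close>-domain is an integral domain together with an embedding of the field \<open>k\<close> as a subring.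
\<close>

locale k_domain =
  fixes \<iota> :: "'k::field \<Rightarrow> 'b::idom"
  assumes one: "\<iota> 1 = 1"
    and add: "\<iota> (x + y) = \<iota> x + \<iota> y"
    and mult: "\<iota> (x * y) = \<iota> x * \<iota> y"
    and inj: "inj \<iota>"

text \<open>
  No \<open>k\<close>-linearity is required here: a locally nilpotent derivation of a domain of characteristic
  zero vanishes on every unit, hence on \<open>k\<close>, and so is automatically \<open>k\<close>-linear.
\<close>

definition derivation :: "('b::comm_ring_1 \<Rightarrow> 'b) \<Rightarrow> bool" where
  "derivation D \<longleftrightarrow> additive D \<and> (\<forall>x y. D (x * y) = D x * y + x * D y)"

definition locally_nilpotent_derivation :: "('b::comm_ring_1 \<Rightarrow> 'b) \<Rightarrow> bool" where
  "locally_nilpotent_derivation D \<longleftrightarrow> derivation D \<and> (\<forall>b. \<exists>m>0. (D ^^ m) b = 0)"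

definition ker :: "('b::zero \<Rightarrow> 'b) \<Rightarrow> 'b set" where
  "ker D = {b. D b = 0}"

text \<open>
  The collection \<open>{D\<^sub>1, \<dots>, D\<^sub>n}\<close> is encoded as a family indexed by \<open>{1..n}\<close>. Repetitions are not
  excluded; both linear independence and irredundancy of the family rule them out.
\<close>

definition pairwise_commuting :: "nat \<Rightarrow> (nat \<Rightarrow> 'b \<Rightarrow> 'b) \<Rightarrow> bool" where
  "pairwise_commuting n D \<longleftrightarrow> (\<forall>i\<in>{1..n}. \<forall>j\<in>{1..n}. D i \<circ> D j = D j \<circ> D i)"

definition linearly_independent :: "nat \<Rightarrow> (nat \<Rightarrow> 'b \<Rightarrow> 'b::comm_ring_1) \<Rightarrow> bool" where
  "linearly_independent n D \<longleftrightarrow>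
    (\<forall>c :: nat \<Rightarrow> 'b. (\<forall>x. (\<Sum>i\<in>{1..n}. c i * D i x) = 0) \<longrightarrow> (\<forall>i\<in>{1..n}. c i = 0))"

definition irredundant_pairwise_commuting_lnds ::
    "nat \<Rightarrow> (nat \<Rightarrow> 'b \<Rightarrow> 'b::comm_ring_1) \<Rightarrow> bool" where
  "irredundant_pairwise_commuting_lnds n D \<longleftrightarrow>
    (\<forall>i\<in>{1..n}. locally_nilpotent_derivation (D i)) \<and>
    pairwise_commuting n D \<and>
    (\<forall>i\<in>{1..n}. \<not> (\<Inter>j\<in>{1..n} - {i}. ker (D j)) \<subseteq> ker (D i))"

end

theory Submission
  imports Defs
begin

text \<open>
  If the family is irredundant, pick for each \<open>i\<close> an element killed by every \<open>D\<^sub>j\<close> with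
  \<open>j \<noteq> i\<close> but not by \<open>D\<^sub>i\<close>; evaluating a linear relation there isolates its \<open>i\<close>-th coefficient
  (\<open>irredundant_imp_independent_on\<close>).

  For the converse, argue by induction on the size of the family. Fix \<open>i\<close>. The \<open>D\<^sub>j\<close> with
  \<open>j \<noteq> i\<close> are still independent, hence irredundant by induction, and so each of them has a
  local slice \<open>a\<^sub>j\<close>: a common constant of the remaining \<open>D\<^sub>l\<close> with \<open>l \<noteq> i, j\<close> for which
  \<open>s\<^sub>j = D\<^sub>j a\<^sub>j\<close> is nonzero and \<open>D\<^sub>j s\<^sub>j = 0\<close>. Let \<open>A\<close> be the common kernel of these \<open>D\<^sub>j\<close>.
  After inverting the \<open>s\<^sub>j\<close> the ring is the polynomial ring in the \<open>a\<^sub>j\<close> over the localized \<open>A\<close>,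
  so a derivation that vanishes on \<open>A\<close> and on all \<open>a\<^sub>j\<close> is zero. No localization has to be constructed for this:
  it is enough to remove one \<open>D\<^sub>j\<close> at a time, cancelling the leading term in \<open>a\<^sub>j\<close>
  (\<open>vanishes_if_vanishes_on_kernel_and_slice\<close>). If now \<open>A \<subseteq> ker D\<^sub>i\<close>, then
  \<open>(\<Prod>l. s\<^sub>l) D\<^sub>i - (\<Sum>j. (\<Prod>l\<noteq>j. s\<^sub>l) D\<^sub>i(a\<^sub>j) D\<^sub>j)\<close>, with \<open>j\<close> and \<open>l\<close> different from \<open>i\<close>,
  is such a derivation, so it is zero; this is a linear relation in which the coefficient of
  \<open>D\<^sub>i\<close> is nonzero, contradicting independence.
\<close>

section \<open>Derivations\<close>

lemma derivation_mult: "derivation D \<Longrightarrow> D (x * y) = D x * y + x * D y"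
  by (simp add: derivation_def)

lemma derivation_zero: "derivation D \<Longrightarrow> D 0 = 0"
  by (simp add: derivation_def additive.zero)

lemma derivation_diff: "derivation D \<Longrightarrow> D (x - y) = D x - D y"
  by (simp add: derivation_def additive.diff)

lemma derivation_one:
  assumes "derivation D"
  shows "D 1 = 0"
  using derivation_mult[OF assms, of 1 1] by simp

lemma derivation_of_nat:
  assumes "derivation D"
  shows "D (of_nat n) = 0"
proof (induction n)
  case 0
  show ?case using derivation_zero[OF assms] by simp
next
  case (Suc n)
  then show ?case
    using assms derivation_one[OF assms] by (simp add: derivation_def additive.add)
qed

lemma derivation_power:
  assumes "derivation D"
  shows "D (a ^ Suc k) = of_nat (Suc k) * a ^ k * D a"
proof (induction k)
  case 0
  show ?case by simp
next
  case (Suc k)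
  have "D (a ^ Suc (Suc k)) = D a * a ^ Suc k + a * D (a ^ Suc k)"
    using derivation_mult[OF assms, of a "a ^ Suc k"] by simp
  also have "\<dots> = of_nat (Suc (Suc k)) * a ^ Suc k * D a"
    unfolding Suc.IH by (simp add: algebra_simps)
  finally show ?case .
qed

lemma derivation_power_eq_0:
  assumes "derivation D" "D a = 0"
  shows "D (a ^ k) = 0"
  using derivation_power[OF assms(1), of a "k - 1"] derivation_one[OF assms(1)] assms(2)
  by (cases k) auto

lemma derivation_funpow_diff:
  assumes "derivation D"
  shows "(D ^^ k) (x - y) = (D ^^ k) x - (D ^^ k) y"
  by (induction k) (auto simp: derivation_diff[OF assms])

lemma derivation_funpow_constant_mult:
  assumes "derivation D" "D c = 0"
  shows "(D ^^ k) (c * x) = c * (D ^^ k) x"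
  by (induction k) (auto simp: derivation_mult[OF assms(1)] assms(2))

lemma derivation_funpow_slice_power:
  assumes D: "derivation D" and s: "D (D a) = 0"
  shows "(D ^^ k) (a ^ k) = of_nat (fact k) * D a ^ k"
proof (induction k)
  case 0
  show ?case by simp
next
  case (Suc k)
  let ?c = "of_nat (Suc k) * D a"
  have c: "D ?c = 0"
    using derivation_mult[OF D] derivation_of_nat[OF D, of "Suc k"] s by (simp del: of_nat_Suc)
  have "(D ^^ Suc k) (a ^ Suc k) = (D ^^ k) (?c * a ^ k)"
    unfolding funpow_Suc_right comp_def derivation_power[OF D] by (simp add: ac_simps)
  also have "\<dots> = of_nat (fact (Suc k)) * D a ^ Suc k"
    unfolding derivation_funpow_constant_mult[OF D c] Suc.IH by (simp add: algebra_simps)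
  finally show ?case .
qed

lemma derivation_linear_combination:
  assumes "\<And>j. j \<in> J \<Longrightarrow> derivation (D j)"
  shows "derivation (\<lambda>x. \<Sum>j\<in>J. c j * D j x)"
proof -
  have "D j (x + y) = D j x + D j y" if "j \<in> J" for j x y
    using assms[OF that] by (simp add: derivation_def additive.add)
  then have "additive (\<lambda>x. \<Sum>j\<in>J. c j * D j x)"
    by unfold_locales (simp add: algebra_simps sum.distrib)
  moreover have "(\<Sum>j\<in>J. c j * D j (x * y))
      = (\<Sum>j\<in>J. c j * D j x) * y + x * (\<Sum>j\<in>J. c j * D j y)" for x y
  proof -
    have "(\<Sum>j\<in>J. c j * D j (x * y)) = (\<Sum>j\<in>J. c j * D j x * y + x * (c j * D j y))"
      using derivation_mult[OF assms] by (intro sum.cong) (auto simp: algebra_simps)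
    then show ?thesis
      by (simp add: sum.distrib sum_distrib_left sum_distrib_right)
  qed
  ultimately show ?thesis by (simp add: derivation_def)
qed

section \<open>Derivations determined by constants and local slices\<close>

text \<open>
  With \<open>D\<^sup>k\<^sup>+\<^sup>1 b = 0\<close>, the element \<open>k! (D a)\<^sup>k b\<close> is a polynomial in \<open>a\<close> with coefficients in
  the constants of \<open>D\<close>, whose leading coefficient is \<open>D\<^sup>k b\<close>. Subtracting the leading term
  lowers the nilpotency order, so an induction on that order applies; the factor \<open>k! (D a)\<^sup>k\<close> is
  a constant and may be cancelled, because the ring is a domain of characteristic zero.
  Working inside a \<open>D\<close>-stable subring \<open>C\<close> makes it possible to iterate over commuting derivations.
\<close>

lemma vanishes_if_vanishes_on_kernel_and_slice:
  fixes D F :: "'b::idom \<Rightarrow> 'b"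
  assumes char0: "\<And>m. m > 0 \<Longrightarrow> of_nat m \<noteq> (0::'b)"
    and D: "locally_nilpotent_derivation D"
    and F: "derivation F"
    and one: "1 \<in> C"
    and diff: "\<And>x y. x \<in> C \<Longrightarrow> y \<in> C \<Longrightarrow> x - y \<in> C"
    and mult: "\<And>x y. x \<in> C \<Longrightarrow> y \<in> C \<Longrightarrow> x * y \<in> C"
    and stable: "\<And>x. x \<in> C \<Longrightarrow> D x \<in> C"
    and a: "a \<in> C" "D a \<noteq> 0" "D (D a) = 0" "F a = 0"
    and kernel: "\<And>x. x \<in> C \<Longrightarrow> D x = 0 \<Longrightarrow> F x = 0"
    and b: "b \<in> C"
  shows "F b = 0"
proof -
  have der: "derivation D"
    using D by (simp add: locally_nilpotent_derivation_def)
  have zero: "0 \<in> C"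
    using diff[OF one one] by simp
  have nat: "of_nat m \<in> C" for m
  proof (induction m)
    case (Suc m)
    then have "1 - (0 - of_nat m) \<in> C" by (intro diff one zero)
    then show ?case by simp
  qed (simp add: zero)
  have pow: "x ^ m \<in> C" if "x \<in> C" for x m
    by (induction m) (auto simp: one mult that)
  have funpow: "(D ^^ m) x \<in> C" if "x \<in> C" for x m
    by (induction m) (auto simp: stable that)
  have "F x = 0" if "x \<in> C" "(D ^^ Suc k) x = 0" for k x
    using that
  proof (induction k arbitrary: x)
    case 0
    then show ?case using kernel by simp
  next
    case (Suc k)
    let ?m = "Suc k"
    define d where "d = (D ^^ ?m) x"
    define u where "u = of_nat (fact ?m) * D a ^ ?m"
    have d: "d \<in> C" "D d = 0"
      using funpow[OF Suc.prems(1), of ?m] Suc.prems(2) by (simp_all add: d_def)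
    have u: "u \<in> C" "D u = 0" "u \<noteq> 0"
      using mult[OF nat pow[OF stable[OF a(1)]]] derivation_mult[OF der] derivation_of_nat[OF der]
        derivation_power_eq_0[OF der a(3)] char0[of "fact ?m"] a(2)
      unfolding u_def by (simp_all del: fact_Suc of_nat_fact power_Suc)
    have "(D ^^ ?m) (u * x - d * a ^ ?m) = 0"
      unfolding derivation_funpow_diff[OF der] derivation_funpow_constant_mult[OF der u(2)]
        derivation_funpow_constant_mult[OF der d(2)] derivation_funpow_slice_power[OF der a(3)]
        d_def[symmetric] u_def[symmetric]
      by (simp add: mult.commute)
    moreover have "u * x - d * a ^ ?m \<in> C"
      using u d a Suc.prems by (intro diff mult pow)
    ultimately have "F (u * x - d * a ^ ?m) = 0"
      by (intro Suc.IH)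
    moreover have "F (d * a ^ ?m) = 0"
      using derivation_mult[OF F, of d "a ^ ?m"] kernel[OF d] derivation_power_eq_0[OF F a(4), of ?m]
      by (simp del: power_Suc)
    moreover have "F (u * x) = u * F x"
      using derivation_mult[OF F, of u x] kernel[OF u(1,2)] by simp
    ultimately show ?case
      using u(3) derivation_diff[OF F] by simp
  qed
  moreover obtain m where "m > 0" "(D ^^ m) b = 0"
    using D by (auto simp: locally_nilpotent_derivation_def)
  ultimately show ?thesis
    using b gr0_implies_Suc by blast
qed

text \<open>
  The common kernel of a subfamily is stable under the remaining derivations, so the members of
  \<open>J\<close> can be discarded one at a time: in the induction \<open>L\<close> is the set of discarded indices.
\<close>

lemma vanishes_if_vanishes_on_common_kernel_and_slices:
  fixes D :: "nat \<Rightarrow> 'b::idom \<Rightarrow> 'b"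
  assumes char0: "\<And>m. m > 0 \<Longrightarrow> of_nat m \<noteq> (0::'b)"
    and fin: "finite J"
    and D: "\<And>j. j \<in> J \<Longrightarrow> locally_nilpotent_derivation (D j)"
    and comm: "\<And>j l x. j \<in> J \<Longrightarrow> l \<in> J \<Longrightarrow> D j (D l x) = D l (D j x)"
    and F: "derivation F"
    and slice: "\<And>j. j \<in> J \<Longrightarrow> D j (a j) \<noteq> 0 \<and> D j (D j (a j)) = 0 \<and> F (a j) = 0"
    and slice_const: "\<And>j l. j \<in> J \<Longrightarrow> l \<in> J \<Longrightarrow> l \<noteq> j \<Longrightarrow> D l (a j) = 0"
    and kernel: "\<And>x. \<forall>l\<in>J. D l x = 0 \<Longrightarrow> F x = 0"
  shows "F x = 0"
proof -
  have der: "derivation (D j)" if "j \<in> J" for j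
    using D[OF that] by (simp add: locally_nilpotent_derivation_def)
  have "F x = 0" if "L \<subseteq> J" "\<forall>l\<in>J - L. D l x = 0" for L x
    using finite_subset[OF that(1) fin] that
  proof (induction L arbitrary: x rule: finite_induct)
    case empty
    then show ?case using kernel by simp
  next
    case (insert j L)
    have j: "j \<in> J" using insert.prems by simp
    let ?C = "{y. \<forall>l\<in>J - insert j L. D l y = 0}"
    show ?case
    proof (rule vanishes_if_vanishes_on_kernel_and_slice[OF char0 D[OF j] F, where C = ?C and a = "a j"])
      show "1 \<in> ?C" using der derivation_one by blast
      show "y - z \<in> ?C" if "y \<in> ?C" "z \<in> ?C" for y z
        using that by (auto simp: derivation_diff[OF der])
      show "y * z \<in> ?C" if "y \<in> ?C" "z \<in> ?C" for y z
        using that by (auto simp: derivation_mult[OF der])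
      show "D j y \<in> ?C" if "y \<in> ?C" for y
      proof -
        have "D l (D j y) = 0" if l: "l \<in> J - insert j L" for l
        proof -
          have "D l (D j y) = D j (D l y)" using comm j l by simp
          also have "\<dots> = 0" using \<open>y \<in> ?C\<close> l derivation_zero[OF der[OF j]] by simp
          finally show ?thesis .
        qed
        then show ?thesis by simp
      qed
      show "a j \<in> ?C" using slice_const[OF j] by auto
      show "F y = 0" if "y \<in> ?C" "D j y = 0" for y
        using that insert.prems by (intro insert.IH) auto
      show "x \<in> ?C" using insert.prems by simp
    qed (use slice[OF j] in auto)
  qed
  from this[of J] show ?thesis by simp
qed

section \<open>Independence and irredundancy\<close>

text \<open>
  Arbitrary finite index sets are used because the induction removes an arbitrary member of the
  family.
\<close>

definition independent_on :: "nat set \<Rightarrow> (nat \<Rightarrow> 'b \<Rightarrow> 'b::comm_ring_1) \<Rightarrow> bool" where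
  "independent_on J D \<longleftrightarrow>
    (\<forall>c :: nat \<Rightarrow> 'b. (\<forall>x. (\<Sum>i\<in>J. c i * D i x) = 0) \<longrightarrow> (\<forall>i\<in>J. c i = 0))"

definition irredundant_on :: "nat set \<Rightarrow> (nat \<Rightarrow> 'b \<Rightarrow> 'b::comm_ring_1) \<Rightarrow> bool" where
  "irredundant_on J D \<longleftrightarrow> (\<forall>i\<in>J. \<exists>x. (\<forall>j\<in>J - {i}. D j x = 0) \<and> D i x \<noteq> 0)"

lemma irredundant_imp_independent_on:
  fixes D :: "nat \<Rightarrow> 'b \<Rightarrow> 'b::idom"
  assumes "finite J" "irredundant_on J D"
  shows "independent_on J D"
  unfolding independent_on_def
proof (intro allI impI ballI)
  fix c :: "nat \<Rightarrow> 'b" and i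
  assume c: "\<forall>x. (\<Sum>j\<in>J. c j * D j x) = 0" and i: "i \<in> J"
  obtain x where x: "\<forall>j\<in>J - {i}. D j x = 0" "D i x \<noteq> 0"
    using assms(2) i unfolding irredundant_on_def by blast
  have "(\<Sum>j\<in>J. c j * D j x) = c i * D i x + (\<Sum>j\<in>J - {i}. c j * D j x)"
    by (rule sum.remove[OF assms(1) i])
  also have "(\<Sum>j\<in>J - {i}. c j * D j x) = 0"
    using x(1) by simp
  finally show "c i = 0"
    using c x(2) by simp
qed

lemma independent_on_subset:
  fixes D :: "nat \<Rightarrow> 'b \<Rightarrow> 'b::comm_ring_1"
  assumes "finite J" "independent_on J D" "K \<subseteq> J"
  shows "independent_on K D"
  unfolding independent_on_def
proof (intro allI impI)
  fix c :: "nat \<Rightarrow> 'b"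
  assume c: "\<forall>x. (\<Sum>i\<in>K. c i * D i x) = 0"
  define c' where "c' i = (if i \<in> K then c i else 0)" for i
  have "(\<Sum>i\<in>J. c' i * D i x) = (\<Sum>i\<in>K. c i * D i x)" for x
    using assms(1,3) by (intro sum.mono_neutral_cong_right) (auto simp: c'_def)
  then have "\<forall>i\<in>J. c' i = 0"
    using assms(2) c unfolding independent_on_def by simp
  then show "\<forall>i\<in>K. c i = 0"
    using assms(3) by (auto simp: c'_def split: if_splits)
qed

text \<open>
  A witness of irredundancy becomes a local slice after applying \<open>D\<^sub>j\<close> to it as often as possible
  while keeping it outside \<open>ker D\<^sub>j\<close>; commutation keeps it inside the other kernels.
\<close>

lemma irredundant_imp_slice:
  fixes D :: "nat \<Rightarrow> 'b \<Rightarrow> 'b::comm_ring_1"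
  assumes D: "\<And>j. j \<in> J \<Longrightarrow> locally_nilpotent_derivation (D j)"
    and comm: "\<And>j l x. j \<in> J \<Longrightarrow> l \<in> J \<Longrightarrow> D j (D l x) = D l (D j x)"
    and irr: "irredundant_on J D" and j: "j \<in> J"
  shows "\<exists>a. D j a \<noteq> 0 \<and> D j (D j a) = 0 \<and> (\<forall>l\<in>J - {j}. D l a = 0)"
proof -
  obtain x where x: "\<forall>l\<in>J - {j}. D l x = 0" "D j x \<noteq> 0"
    using irr j unfolding irredundant_on_def by blast
  have ex: "\<exists>m. (D j ^^ m) x = 0"
    using D[OF j] by (auto simp: locally_nilpotent_derivation_def)
  define m where "m = (LEAST m. (D j ^^ m) x = 0)"
  have m: "(D j ^^ m) x = 0"
    unfolding m_def by (rule LeastI_ex[OF ex])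
  have least: "(D j ^^ k) x \<noteq> 0" if "k < m" for k
    using not_less_Least that unfolding m_def by blast
  have zero: "D j 0 = 0"
    using D[OF j] by (simp add: locally_nilpotent_derivation_def derivation_zero)
  have "m \<noteq> 0"
    using m x(2) zero by (metis funpow_0)
  moreover have "m \<noteq> 1"
    using m x(2) by auto
  ultimately obtain k where k: "m = Suc (Suc k)"
    by (metis One_nat_def not0_implies_Suc)
  have "D l ((D j ^^ i) x) = 0" if l: "l \<in> J - {j}" for l i
    using x(1) l comm[of l j] j zero by (induction i) auto
  then show ?thesis
    using m least[of "Suc k"] unfolding k by (intro exI[of _ "(D j ^^ k) x"]) simp
qed

lemma independent_imp_irredundant_on:
  fixes D :: "nat \<Rightarrow> 'b::idom \<Rightarrow> 'b"
  assumes char0: "\<And>m. m > 0 \<Longrightarrow> of_nat m \<noteq> (0::'b)"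
    and "finite J"
    and "\<And>j. j \<in> J \<Longrightarrow> locally_nilpotent_derivation (D j)"
    and "\<And>j l x. j \<in> J \<Longrightarrow> l \<in> J \<Longrightarrow> D j (D l x) = D l (D j x)"
    and "independent_on J D"
  shows "irredundant_on J D"
  using assms(2-)
proof (induction J rule: finite_psubset_induct)
  case (psubset J)
  note D = psubset.prems(1) and comm = psubset.prems(2) and indep = psubset.prems(3)
  have "\<exists>x. (\<forall>j\<in>J - {i}. D j x = 0) \<and> D i x \<noteq> 0" if i: "i \<in> J" for i
  proof (rule ccontr)
    assume "\<not> ?thesis"
    then have const: "D i x = 0" if "\<forall>j\<in>J - {i}. D j x = 0" for x
      using that by blast
    let ?K = "J - {i}"
    have finK: "finite ?K" using psubset.hyps by simp
    have irrK: "irredundant_on ?K D"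
    proof (rule psubset.IH)
      show "?K \<subset> J" using i by blast
      show "independent_on ?K D"
        using independent_on_subset[OF psubset.hyps(1) indep] by blast
    qed (use D comm in auto)
    have "\<exists>a. D j a \<noteq> 0 \<and> D j (D j a) = 0 \<and> (\<forall>l\<in>?K - {j}. D l a = 0)" if "j \<in> ?K" for j
      using that by (intro irredundant_imp_slice[OF D comm irrK]) auto
    then obtain a where a: "\<And>j. j \<in> ?K \<Longrightarrow>
        D j (a j) \<noteq> 0 \<and> D j (D j (a j)) = 0 \<and> (\<forall>l\<in>?K - {j}. D l (a j) = 0)"
      by metis
    define s where "s j = D j (a j)" for j
    \<comment> \<open>coefficients chosen so that the combination \<open>F\<close> kills every slice, the
      denominators of \<open>D\<^sub>i = (\<Sum>j. (D\<^sub>i a\<^sub>j / s\<^sub>j) D\<^sub>j)\<close> being cleared\<close>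
    define c where "c j = (if j = i then \<Prod>l\<in>?K. s l
      else - ((\<Prod>l\<in>?K - {j}. s l) * D i (a j)))" for j
    define F where "F x = (\<Sum>j\<in>J. c j * D j x)" for x
    have F_eq: "F x = c i * D i x + (\<Sum>j\<in>?K. c j * D j x)" for x
      unfolding F_def by (rule sum.remove[OF psubset.hyps(1) i])
    have F_der: "derivation F"
      unfolding F_def
      by (rule derivation_linear_combination) (use D in \<open>simp add: locally_nilpotent_derivation_def\<close>)
    have F_slice: "F (a j) = 0" if j: "j \<in> ?K" for j
    proof -
      have "(\<Sum>l\<in>?K. c l * D l (a j)) = c j * s j + (\<Sum>l\<in>?K - {j}. c l * D l (a j))"
        unfolding s_def by (rule sum.remove[OF finK j])
      also have "(\<Sum>l\<in>?K - {j}. c l * D l (a j)) = 0"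
        using a[OF j] by (intro sum.neutral) simp
      finally have "F (a j) = c i * D i (a j) + c j * s j"
        by (simp add: F_eq)
      moreover have "c i = s j * (\<Prod>l\<in>?K - {j}. s l)"
        unfolding c_def using prod.remove[OF finK j] by simp
      moreover have "c j = - ((\<Prod>l\<in>?K - {j}. s l) * D i (a j))"
        using j by (simp add: c_def)
      ultimately show ?thesis by (simp add: algebra_simps)
    qed
    have "F x = 0" for x
    proof (rule vanishes_if_vanishes_on_common_kernel_and_slices[OF char0 finK _ _ F_der])
      show "F y = 0" if "\<forall>l\<in>?K. D l y = 0" for y
        using that const[OF that] by (simp add: F_eq)
      show "D j (a j) \<noteq> 0 \<and> D j (D j (a j)) = 0 \<and> F (a j) = 0" if "j \<in> ?K" for j
        using a[OF that] F_slice[OF that] by blast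
      show "D l (a j) = 0" if "j \<in> ?K" "l \<in> ?K" "l \<noteq> j" for j l
        using a[OF that(1)] that by blast
    qed (use D comm in auto)
    then have "c i = 0"
      using indep i unfolding independent_on_def F_def by blast
    moreover have "c i \<noteq> 0"
      using finK a by (simp add: c_def s_def)
    ultimately show False by blast
  qed
  then show ?case by (simp add: irredundant_on_def)
qed

lemma k_domain_of_nat_neq_0:
  fixes \<iota> :: "'k::field_char_0 \<Rightarrow> 'b::idom"
  assumes "k_domain \<iota>" "m > 0"
  shows "of_nat m \<noteq> (0::'b)"
proof -
  interpret k_domain \<iota> by fact
  have "\<iota> 0 + \<iota> 0 = \<iota> 0 + 0" using add[of 0 0] by simp
  then have zero: "\<iota> 0 = 0" by (simp only: add_left_cancel)
  have "\<iota> (of_nat m) = of_nat m" for m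
    by (induction m) (auto simp: zero add one)
  then show ?thesis
    using zero inj assms(2) by (metis injD of_nat_eq_0_iff less_irrefl)
qed

theorem proposition4p13:
  fixes \<iota> :: "'k::field_char_0 \<Rightarrow> 'b::idom"
    and D :: "nat \<Rightarrow> 'b \<Rightarrow> 'b"
    and n :: nat
  assumes "k_domain \<iota>"
    and "\<forall>i\<in>{1..n}. locally_nilpotent_derivation (D i)"
  shows "pairwise_commuting n D \<and> linearly_independent n D
    \<longleftrightarrow> irredundant_pairwise_commuting_lnds n D"
proof -
  have indep: "linearly_independent n D \<longleftrightarrow> independent_on {1..n} D"
    by (simp add: linearly_independent_def independent_on_def)
  have "(\<forall>i\<in>{1..n}. \<not> (\<Inter>j\<in>{1..n} - {i}. ker (D j)) \<subseteq> ker (D i)) \<longleftrightarrow> irredundant_on {1..n} D"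
    unfolding irredundant_on_def ker_def by blast
  then have irr: "irredundant_pairwise_commuting_lnds n D \<longleftrightarrow>
      pairwise_commuting n D \<and> irredundant_on {1..n} D"
    using assms(2) unfolding irredundant_pairwise_commuting_lnds_def by blast
  have "irredundant_on {1..n} D" if "pairwise_commuting n D" "independent_on {1..n} D"
  proof (rule independent_imp_irredundant_on)
    show "D j (D l x) = D l (D j x)" if "j \<in> {1..n}" "l \<in> {1..n}" for j l x
      using \<open>pairwise_commuting n D\<close> that unfolding pairwise_commuting_def
      by (metis comp_apply)
  qed (use assms(2) that k_domain_of_nat_neq_0[OF assms(1)] in auto)
  then show ?thesis
    using indep irr irredundant_imp_independent_on[of "{1..n}" D] by blast
qed

end
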